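(* For $0<\epsilon\le 1$ let $Q_\epsilon^{\mathrm{RURWM}}$ be the Markov kernel on $[-1,1]$ defined by $Q_\epsilon^{\mathrm{RURWM}}(x,\cdot)=\text{law of }R(x+\xi)$ with $\xi\sim\mathcal U(-\epsilon,\epsilon)$, where $R$ is the reflection map at the boundary points $-1$ and $1$. Let $$\beta_\epsilon=\sup_{0\neq f\in L_0^2(\mathcal U(-1,1))}\frac{\|Q_\epsilon^{\mathrm{RURWM}}f\|_{2}}{\|f\|_{2}} .$$ Then there is a constant $c>0$ (independent of $\epsilon$) such that for all $0<\epsilon\le1$ the $L^2_{\mathcal U(-1,1)}$-spectral gap $1-\beta_\epsilon$ of $Q_\epsilon^{\mathrm{RURWM}}$ satisfies $$1-\beta_\epsilon\ge c\,\epsilon^2 .$$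
   Context: $\mathcal U(a,b)$ denotes the uniform probability distribution on $[a,b]$. The reflection map $R:\mathbb R\to[-1,1]$ is $$R(x)=\begin{cases} y & y\le 1\\ 2-y & 1<y<3\\ y-4 & 3\le y\le 4\end{cases}\qquad\text{where } y= x \bmod 4\in[0,4),$$ i.e. repeated reflection at $-1$ and $1$. A Markov kernel $Q$ acts on functions by $Qf(x)=\int f(y)Q(x,dy)$. The kernel $Q_\epsilon^{\mathrm{RURWM}}$ is reversible with respect to $\mathcal U(-1,1)$. $L_0^2(\mathcal U(-1,1))$ is the space of functions in $L^2(\mathcal U(-1,1))$ with mean zero under $\mathcal U(-1,1)$, and norms are in $L^2(\mathcal U(-1,1))$. *)

theory Defs
  imports "HOL-Probability.Probability" "HOL-Library.Real_Mod"
begin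

definition unif :: "real \<Rightarrow> real \<Rightarrow> real measure" where
  "unif a b = uniform_measure lborel {a..b}"

definition reflect :: "real \<Rightarrow> real" where
  "reflect x = (let y = x rmod 4 in
     if y \<le> 1 then y else if y < 3 then 2 - y else y - 4)"

text \<open>
  The state space \<open>[-1, 1]\<close> is embedded in the real line: the reference measure
  \<open>unif (-1) 1\<close> and all kernel measures below are Borel measures on the reals carried by
  \<open>[-1, 1]\<close>, so the values of functions outside \<open>[-1, 1]\<close> are irrelevant.
\<close>

definition Q_RURWM :: "real \<Rightarrow> real \<Rightarrow> real measure" where
  "Q_RURWM \<epsilon> x = distr (unif (- \<epsilon>) \<epsilon>) borel (\<lambda>\<xi>. reflect (x + \<xi>))"

definition kernel_op :: "('a \<Rightarrow> 'a measure) \<Rightarrow> ('a \<Rightarrow> real) \<Rightarrow> 'a \<Rightarrow> real" where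
  "kernel_op Q f x = (\<integral>y. f y \<partial>Q x)"

definition L2_norm :: "'a measure \<Rightarrow> ('a \<Rightarrow> real) \<Rightarrow> real" where
  "L2_norm M f = sqrt (\<integral>x. (f x)\<^sup>2 \<partial>M)"

text \<open>
  Elements of the spaces \<open>L\<^sup>2\<close> are represented by functions, not equivalence
  classes; accordingly, \<open>f \<noteq> 0\<close> in \<open>L\<^sup>2\<close> means that \<open>f\<close> is not almost everywhere zero.
\<close>

definition L2_zero_mean :: "'a measure \<Rightarrow> ('a \<Rightarrow> real) set" where
  "L2_zero_mean M =
     {f \<in> borel_measurable M. integrable M (\<lambda>x. (f x)\<^sup>2) \<and> (\<integral>x. f x \<partial>M) = 0}"

definition L2_contraction :: "'a measure \<Rightarrow> ('a \<Rightarrow> 'a measure) \<Rightarrow> real" where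
  "L2_contraction M Q =
     (SUP f \<in> {f \<in> L2_zero_mean M. \<not> (AE x in M. f x = 0)}.
        L2_norm M (kernel_op Q f) / L2_norm M f)"

definition L2_spectral_gap :: "'a measure \<Rightarrow> ('a \<Rightarrow> 'a measure) \<Rightarrow> real" where
  "L2_spectral_gap M Q = 1 - L2_contraction M Q"

lemma reflect_in_range: "reflect x \<in> {-1..1}"
  using rmod_nonneg[of 4 x] rmod_less[of 4 x] by (auto simp: reflect_def Let_def)

lemma measurable_reflect [measurable]: "reflect \<in> borel_measurable borel"
  unfolding reflect_def rmod_def Let_def by measurable

lemma prob_space_unif: "a < b \<Longrightarrow> prob_space (unif a b)"
  unfolding unif_def by (rule prob_space_uniform_measure) auto

lemma prob_space_Q_RURWM:
  assumes "0 < \<epsilon>"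
  shows "prob_space (Q_RURWM \<epsilon> x)"
proof -
  interpret prob_space "unif (- \<epsilon>) \<epsilon>"
    using assms by (intro prob_space_unif) auto
  have "(\<lambda>\<xi>. reflect (x + \<xi>)) \<in> borel_measurable (unif (- \<epsilon>) \<epsilon>)"
    unfolding unif_def by simp
  then show ?thesis
    unfolding Q_RURWM_def by (rule prob_space_distr)
qed

end

theory Submission
  imports Defs
begin

text \<open>
  Reflection unfolds to a translation-invariant problem: for \<open>f\<close> on \<open>[-1, 1]\<close> the function
  \<open>g = f \<circ> reflect\<close> is 4-periodic, averages over one period of \<open>g\<close> are averages of \<open>f\<close> over
  \<open>[-1, 1]\<close>, and the kernel becomes averaging of \<open>g (x + \<xi>)\<close> over \<open>\<xi> \<sim> \<U>(-\<epsilon>, \<epsilon>)\<close>.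
  What the averaging loses in \<open>L\<^sup>2\<close>-norm is a mean variance. With
  \<open>D h = \<parallel>g (\<sqdot> + h) - g\<parallel>\<^sup>2\<close> (\<open>sq_increment\<close>), the norm on the circle of length 4 taken with respect
  to the uniform probability measure, and \<open>V r\<close> the mean of \<open>D (\<xi> - \<eta>)\<close> over independent
  \<open>\<xi>, \<eta> \<sim> \<U>(-r, r)\<close> (\<open>mean_sq_increment\<close>), translation invariance gives for every \<open>r\<close>
  the identity \<open>energy_identity\<close>: twice the squared norm of the average of \<open>g\<close> over windows of
  radius \<open>r\<close>, plus \<open>V r\<close>, is \<open>2 \<parallel>g\<parallel>\<^sup>2\<close>.

  The identity is used twice. For \<open>r = \<epsilon>\<close> it says that the loss is \<open>V \<epsilon> / 2\<close>. For \<open>r = 2\<close> the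
  window is a full period, so for \<open>f\<close> of mean zero the average vanishes and \<open>V 2 = 2 \<parallel>g\<parallel>\<^sup>2\<close>.
  It remains to bound \<open>V 2\<close> by a multiple of \<open>V \<epsilon> / \<epsilon>\<^sup>2\<close>. Splitting a
  translation into \<open>n\<close> equal steps gives \<open>D (n h) \<le> n\<^sup>2 D h\<close> (\<open>sq_increment_mult_le\<close>), hence
  \<open>V 2 \<le> n\<^sup>2 V (2 / n)\<close>; and for \<open>2 / n \<le> \<epsilon>\<close> comparing densities
  gives \<open>V (2 / n) \<le> (n \<epsilon> / 2)\<^sup>2 V \<epsilon>\<close>. For \<open>n = \<lceil>2 / \<epsilon>\<rceil>\<close> one has \<open>n \<epsilon> \<le> 3\<close>, so
  \<open>2 \<parallel>g\<parallel>\<^sup>2 \<le> 81 / (4 \<epsilon>\<^sup>2) V \<epsilon>\<close> (\<open>poincare_circle\<close>). Thus the squared norm contracts by the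
  factor \<open>1 - 4 \<epsilon>\<^sup>2 / 81\<close>, and the norm by at most \<open>1 - 2 \<epsilon>\<^sup>2 / 81\<close>.
\<close>

section \<open>Uniform measures\<close>

lemma sets_unif [simp, measurable_cong]: "sets (unif a b) = sets borel"
  by (simp add: unif_def)

lemma space_unif [simp]: "space (unif a b) = UNIV"
  by (simp add: unif_def)

lemma AE_unif: "AE x in unif a b. x \<in> {a..b}"
  unfolding unif_def by (rule AE_uniform_measureI) auto

lemma nn_integral_unif:
  assumes [measurable]: "F \<in> borel_measurable borel" and "a < b"
  shows "(\<integral>\<^sup>+x. F x \<partial>unif a b) = ennreal (1 / (b - a)) * (\<integral>\<^sup>+x\<in>{a..b}. F x \<partial>lborel)"
  using assms unfolding unif_def
  by (subst nn_integral_uniform_measure)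
     (auto simp: divide_ennreal_def inverse_ennreal inverse_eq_divide mult.commute)

lemma nn_integral_Icc_split:
  fixes F :: "real \<Rightarrow> ennreal"
  assumes [measurable]: "F \<in> borel_measurable borel" and "a \<le> b" "b \<le> c"
  shows "(\<integral>\<^sup>+x\<in>{a..c}. F x \<partial>lborel) = (\<integral>\<^sup>+x\<in>{a..b}. F x \<partial>lborel) + (\<integral>\<^sup>+x\<in>{b..c}. F x \<partial>lborel)"
proof -
  have "(\<integral>\<^sup>+x\<in>{a..c}. F x \<partial>lborel) = (\<integral>\<^sup>+x. F x * indicator {a..b} x + F x * indicator {b..c} x \<partial>lborel)"
    by (rule nn_integral_cong_AE, rule AE_mp[OF AE_lborel_singleton[of b]])
       (use assms in \<open>auto split: split_indicator\<close>)
  then show ?thesis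
    by (simp add: nn_integral_add)
qed

text \<open>
  The minima and maxima let one statement cover both orientations; the negative one
  is used for the reflections \<open>x \<mapsto> 2 - x\<close> and \<open>\<xi> \<mapsto> - \<xi>\<close>.
\<close>
lemma nn_integral_Icc_affine:
  fixes F :: "real \<Rightarrow> ennreal"
  assumes [measurable]: "F \<in> borel_measurable borel" and "c \<noteq> 0"
  shows "(\<integral>\<^sup>+x\<in>{min (t + c * a) (t + c * b)..max (t + c * a) (t + c * b)}. F x \<partial>lborel)
    = ennreal \<bar>c\<bar> * (\<integral>\<^sup>+x\<in>{min a b..max a b}. F (t + c * x) \<partial>lborel)"
proof -
  have "indicator {min (t + c * a) (t + c * b)..max (t + c * a) (t + c * b)} (t + c * x)
      = (indicator {min a b..max a b} x :: ennreal)" for x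
    using \<open>c \<noteq> 0\<close> by (cases "c > 0") (auto simp: indicator_def min_def max_def)
  then show ?thesis
    using \<open>c \<noteq> 0\<close> by (subst nn_integral_real_affine[where c = c and t = t]) auto
qed

lemma distr_unif_affine:
  assumes "a < b" "c \<noteq> 0"
  shows "distr (unif a b) borel (\<lambda>x. t + c * x)
    = unif (min (t + c * a) (t + c * b)) (max (t + c * a) (t + c * b))"
proof (rule measure_eqI)
  fix A assume "A \<in> sets (distr (unif a b) borel (\<lambda>x. t + c * x))"
  then have A [measurable]: "A \<in> sets borel" by simp
  let ?a = "min (t + c * a) (t + c * b)" and ?b = "max (t + c * a) (t + c * b)"
  have len: "?b - ?a = \<bar>c\<bar> * (b - a)"
    using assms by (cases "c > 0") (auto simp: min_def max_def algebra_simps)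
  then have ab: "?a < ?b"
    using assms by (metis diff_gt_0_iff_gt mult_pos_pos zero_less_abs_iff)
  have "emeasure (unif ?a ?b) A = (\<integral>\<^sup>+x. indicator A x \<partial>unif ?a ?b)"
    by simp
  also have "\<dots> = ennreal (1 / (\<bar>c\<bar> * (b - a))) * (\<integral>\<^sup>+x\<in>{?a..?b}. indicator A x \<partial>lborel)"
    by (subst nn_integral_unif[OF _ ab]) (simp_all add: len)
  also have "(\<integral>\<^sup>+x\<in>{?a..?b}. indicator A x \<partial>lborel)
      = ennreal \<bar>c\<bar> * (\<integral>\<^sup>+x\<in>{a..b}. indicator A (t + c * x) \<partial>lborel)"
    using nn_integral_Icc_affine[of "indicator A" c t a b] assms by simp
  also have "ennreal (1 / (\<bar>c\<bar> * (b - a))) * (ennreal \<bar>c\<bar> * (\<integral>\<^sup>+x\<in>{a..b}. indicator A (t + c * x) \<partial>lborel))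
      = ennreal (1 / (b - a)) * (\<integral>\<^sup>+x\<in>{a..b}. indicator A (t + c * x) \<partial>lborel)"
    using assms by (simp flip: mult.assoc ennreal_mult)
  also have "\<dots> = (\<integral>\<^sup>+x. indicator A (t + c * x) \<partial>unif a b)"
    using assms by (subst nn_integral_unif) auto
  also have "\<dots> = emeasure (distr (unif a b) borel (\<lambda>x. t + c * x)) A"
    by (subst nn_integral_distr[symmetric, of "\<lambda>x. t + c * x" _ borel "indicator A"]) auto
  finally show "emeasure (distr (unif a b) borel (\<lambda>x. t + c * x)) A = emeasure (unif ?a ?b) A" ..
qed simp

text \<open>
  The density of \<open>\<U>(-b, b)\<close> is at most \<open>a / b\<close> times that of \<open>\<U>(-a, a)\<close>.
\<close>
lemma nn_integral_unif_mono:
  assumes [measurable]: "F \<in> borel_measurable borel" and "0 < b" "b \<le> a"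
  shows "(\<integral>\<^sup>+x. F x \<partial>unif (-b) b) \<le> ennreal (a / b) * (\<integral>\<^sup>+x. F x \<partial>unif (-a) a)"
proof -
  have "(\<integral>\<^sup>+x. F x \<partial>unif (-b) b) = ennreal (1 / (2 * b)) * (\<integral>\<^sup>+x\<in>{-b..b}. F x \<partial>lborel)"
    using assms by (subst nn_integral_unif) auto
  also have "\<dots> \<le> ennreal (1 / (2 * b)) * (\<integral>\<^sup>+x\<in>{-a..a}. F x \<partial>lborel)"
    using assms by (intro mult_left_mono nn_integral_mono) (auto split: split_indicator)
  also have "1 / (2 * b) = a / b * (1 / (2 * a))"
    using assms by simp
  also have "ennreal (a / b * (1 / (2 * a))) * (\<integral>\<^sup>+x\<in>{-a..a}. F x \<partial>lborel)
      = ennreal (a / b) * (ennreal (1 / (2 * a)) * (\<integral>\<^sup>+x\<in>{-a..a}. F x \<partial>lborel))"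
    using assms by (subst ennreal_mult) (auto simp: mult.assoc)
  also have "ennreal (1 / (2 * a)) * (\<integral>\<^sup>+x\<in>{-a..a}. F x \<partial>lborel) = (\<integral>\<^sup>+x. F x \<partial>unif (-a) a)"
    using assms by (subst nn_integral_unif) auto
  finally show ?thesis .
qed

text \<open>
  By periodicity only the residue \<open>r\<close> of \<open>h\<close> modulo the period matters. Shifting by \<open>r\<close>
  removes the piece \<open>[a, a + r]\<close> of the window and adds its translate by one period.
\<close>
lemma nn_integral_unif_periodic_shift:
  fixes F :: "real \<Rightarrow> ennreal"
  assumes [measurable]: "F \<in> borel_measurable borel"
    and "p > 0" and per: "\<And>x. F (x + p) = F x"
  shows "(\<integral>\<^sup>+x. F (x + h) \<partial>unif a (a + p)) = (\<integral>\<^sup>+x. F x \<partial>unif a (a + p))"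
proof -
  interpret periodic_fun_simple F p
    by unfold_locales (rule per)
  define r where "r = h rmod p"
  have r: "0 \<le> r" "r < p"
    using \<open>p > 0\<close> rmod_less[of p h] by (auto simp: r_def rmod_nonneg)
  have h: "h = r + of_int \<lfloor>h / p\<rfloor> * p"
    using \<open>p > 0\<close> by (simp add: r_def rmod_def)
  have Fh: "F (x + h) = F (x + r)" for x
    by (subst h) (metis add.assoc plus_of_int)
  have shift: "(\<integral>\<^sup>+x\<in>{u + t..v + t}. F x \<partial>lborel) = (\<integral>\<^sup>+x\<in>{u..v}. F (x + t) \<partial>lborel)"
    if "u \<le> v" for u v t
    using nn_integral_Icc_affine[of F 1 t u v] that by (simp add: add.commute)
  have "(\<integral>\<^sup>+x\<in>{a..a+p}. F (x + h) \<partial>lborel) = (\<integral>\<^sup>+x\<in>{a+r..a+p+r}. F x \<partial>lborel)"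
    using \<open>p > 0\<close> by (subst shift) (simp_all add: Fh)
  also have "\<dots> = (\<integral>\<^sup>+x\<in>{a+r..a+p}. F x \<partial>lborel) + (\<integral>\<^sup>+x\<in>{a+p..a+p+r}. F x \<partial>lborel)"
    using r by (intro nn_integral_Icc_split) auto
  also have "(\<integral>\<^sup>+x\<in>{a+p..a+p+r}. F x \<partial>lborel) = (\<integral>\<^sup>+x\<in>{a..a+r}. F x \<partial>lborel)"
    using r shift[of a "a + r" p] by (simp add: per algebra_simps)
  also have "(\<integral>\<^sup>+x\<in>{a+r..a+p}. F x \<partial>lborel) + (\<integral>\<^sup>+x\<in>{a..a+r}. F x \<partial>lborel) = (\<integral>\<^sup>+x\<in>{a..a+p}. F x \<partial>lborel)"
    using r by (subst add.commute, intro nn_integral_Icc_split[symmetric]) auto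
  finally show ?thesis
    using \<open>p > 0\<close> by (simp add: nn_integral_unif)
qed

section \<open>Reflection\<close>

lemma reflect_periodic: "reflect (x + 4) = reflect x"
proof -
  have "(x + 4) rmod 4 = x rmod 4"
    by (simp add: rmod_def add_divide_distrib algebra_simps)
  then show ?thesis
    by (simp add: reflect_def)
qed

lemma reflect_eq_id: "x \<in> {-1..1} \<Longrightarrow> reflect x = x"
proof -
  assume x: "x \<in> {-1..1}"
  have "x rmod 4 = (if x < 0 then x + 4 else x)"
  proof (cases "x < 0")
    case True
    then have "\<lfloor>x / 4\<rfloor> = -1"
      using x by (intro floor_unique) auto
    then show ?thesis
      using True by (simp add: rmod_def)
  qed (use x in auto)
  then show ?thesis using x by (auto simp: reflect_def)
qed

lemma reflect_eq_diff: "x \<in> {1..3} \<Longrightarrow> reflect x = 2 - x"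
proof -
  assume x: "x \<in> {1..3}"
  have "x rmod 4 = x"
    by (rule rmod_idem) (use x in auto)
  then show ?thesis using x by (auto simp: reflect_def)
qed

text \<open>
  It is enough to check \<open>x \<in> [-1, 3]\<close>, where \<open>x \<mapsto> 2 - x\<close> exchanges the increasing
  and the decreasing piece of \<^const>\<open>reflect\<close>.
\<close>
lemma reflect_symmetric: "reflect (2 - x) = reflect x"
proof -
  interpret periodic_fun_simple reflect 4
    by unfold_locales (rule reflect_periodic)
  define y where "y = (x + 1) rmod 4 - 1"
  define k where "k = \<lfloor>(x + 1) / 4\<rfloor>"
  have y: "y \<in> {-1..3}"
    using rmod_less[of 4 "x + 1"] rmod_nonneg[of 4 "x + 1"] by (auto simp: y_def)
  have x: "x = y + of_int k * 4"
    by (simp add: y_def k_def rmod_def)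
  have "reflect (2 - x) = reflect ((2 - y) - of_int k * 4)"
    by (simp add: x algebra_simps)
  also have "\<dots> = reflect (2 - y)"
    by (rule minus_of_int)
  also have "\<dots> = reflect y"
    using y by (cases "y \<le> 1") (auto simp: reflect_eq_id reflect_eq_diff)
  also have "\<dots> = reflect x"
    by (simp add: x plus_of_int)
  finally show ?thesis .
qed

text \<open>
  Over the period \<open>[-1, 3]\<close> reflection is a two-to-one folding, an isometry onto
  \<open>[-1, 1]\<close> on each half.
\<close>
lemma nn_integral_reflect:
  assumes [measurable]: "F \<in> borel_measurable borel"
  shows "(\<integral>\<^sup>+x. F (reflect x) \<partial>unif (-1) 3) = (\<integral>\<^sup>+x. F x \<partial>unif (-1) 1)"
proof -
  let ?I = "\<integral>\<^sup>+x\<in>{-1..1}. F x \<partial>lborel"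
  have "(\<integral>\<^sup>+x\<in>{-1..3}. F (reflect x) \<partial>lborel)
      = (\<integral>\<^sup>+x\<in>{-1..1}. F (reflect x) \<partial>lborel) + (\<integral>\<^sup>+x\<in>{1..3}. F (reflect x) \<partial>lborel)"
    by (rule nn_integral_Icc_split) auto
  also have "(\<integral>\<^sup>+x\<in>{-1..1}. F (reflect x) \<partial>lborel) = ?I"
    by (rule nn_integral_cong) (auto simp: reflect_eq_id split: split_indicator)
  also have "(\<integral>\<^sup>+x\<in>{1..3}. F (reflect x) \<partial>lborel) = (\<integral>\<^sup>+x\<in>{1..3}. F (2 - x) \<partial>lborel)"
    by (rule nn_integral_cong) (auto simp: reflect_eq_diff split: split_indicator)
  also have "\<dots> = ?I"
    using nn_integral_Icc_affine[of F "-1" 2 1 3] by simp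
  finally have I: "(\<integral>\<^sup>+x\<in>{-1..3}. F (reflect x) \<partial>lborel) = ennreal 2 * ?I"
    by (simp add: mult_2)
  have "(\<integral>\<^sup>+x. F (reflect x) \<partial>unif (-1) 3) = ennreal (1 / 4) * (ennreal 2 * ?I)"
    by (subst nn_integral_unif) (auto simp: I)
  also have "\<dots> = ennreal (1 / 2) * ?I"
    by (subst mult.assoc[symmetric], subst ennreal_mult[symmetric]) auto
  also have "\<dots> = (\<integral>\<^sup>+x. F x \<partial>unif (-1) 1)"
    by (subst nn_integral_unif) auto
  finally show ?thesis .
qed

text \<open>
  One step of the walk with increments spread over a full period reaches equilibrium
  from every starting point \<open>x\<close>.
\<close>
lemma distr_reflect_unif_period: "distr (unif a (a + 4)) borel (\<lambda>\<xi>. reflect (x + \<xi>)) = unif (-1) 1"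
proof (rule measure_eqI)
  fix A assume "A \<in> sets (distr (unif a (a + 4)) borel (\<lambda>\<xi>. reflect (x + \<xi>)))"
  then have [measurable]: "A \<in> sets borel" by simp
  let ?F = "\<lambda>x. indicator A (reflect x) :: ennreal"
  have C: "unif (-1) 3 = distr (unif a (a + 4)) borel (\<lambda>x. (-1 - a) + 1 * x)"
    using distr_unif_affine[of a "a + 4" 1 "-1 - a"] by simp
  have per: "?F (x + 4) = ?F x" for x
    by (simp add: reflect_periodic)
  have shift: "(\<integral>\<^sup>+\<xi>. ?F (h + \<xi>) \<partial>unif a (a + 4)) = (\<integral>\<^sup>+\<xi>. ?F \<xi> \<partial>unif a (a + 4))" for h
    using nn_integral_unif_periodic_shift[where F = ?F and p = 4 and h = h and a = a] per
    by (simp add: add.commute)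
  have "emeasure (unif (-1) 1) A = (\<integral>\<^sup>+\<xi>. indicator A \<xi> \<partial>unif (-1) 1)"
    by simp
  also have "\<dots> = (\<integral>\<^sup>+\<xi>. ?F \<xi> \<partial>unif (-1) 3)"
    by (rule nn_integral_reflect[symmetric]) simp
  also have "\<dots> = (\<integral>\<^sup>+\<xi>. ?F ((-1 - a) + 1 * \<xi>) \<partial>unif a (a + 4))"
    unfolding C by (rule nn_integral_distr) auto
  also have "\<dots> = (\<integral>\<^sup>+\<xi>. ?F (x + \<xi>) \<partial>unif a (a + 4))"
    using shift[of "-1 - a"] shift[of x] by simp
  also have "\<dots> = emeasure (distr (unif a (a + 4)) borel (\<lambda>\<xi>. reflect (x + \<xi>))) A"
    by (subst nn_integral_distr[symmetric, of "\<lambda>\<xi>. reflect (x + \<xi>)" _ borel "indicator A"]) auto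
  finally show "emeasure (distr (unif a (a + 4)) borel (\<lambda>\<xi>. reflect (x + \<xi>))) A
      = emeasure (unif (-1) 1) A" ..
qed simp

section \<open>Increments of periodic functions\<close>

text \<open>
  For independent \<open>\<xi>, \<eta>\<close> with law \<open>M\<close> the expectation of \<open>(u \<xi> - u \<eta>)\<^sup>2\<close> is twice the variance of
  \<open>u\<close>. The variance is moved to the side of the squared mean so that the identity needs no
  subtraction of extended nonnegative reals and can be integrated over a further parameter.
\<close>
lemma (in prob_space) square_mean_plus_pair_difference:
  fixes u :: "'a \<Rightarrow> real"
  assumes [measurable]: "u \<in> borel_measurable M" and fin: "(\<integral>\<^sup>+\<xi>. ennreal ((u \<xi>)\<^sup>2) \<partial>M) < \<infinity>"
  shows "2 * ennreal ((\<integral>\<xi>. u \<xi> \<partial>M)\<^sup>2) + (\<integral>\<^sup>+\<xi>. \<integral>\<^sup>+\<eta>. ennreal ((u \<xi> - u \<eta>)\<^sup>2) \<partial>M \<partial>M)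
     = 2 * (\<integral>\<^sup>+\<xi>. ennreal ((u \<xi>)\<^sup>2) \<partial>M)"
proof -
  have i2: "integrable M (\<lambda>\<xi>. (u \<xi>)\<^sup>2)"
    using fin by (intro integrableI_bounded) auto
  have i1: "integrable M u"
    by (rule square_integrable_imp_integrable[OF _ i2]) simp
  define m where "m = (\<integral>\<xi>. u \<xi> \<partial>M)"
  define s where "s = (\<integral>\<xi>. (u \<xi>)\<^sup>2 \<partial>M)"
  have e: "(u \<xi> - u \<eta>)\<^sup>2 = (u \<xi>)\<^sup>2 - 2 * u \<xi> * u \<eta> + (u \<eta>)\<^sup>2" for \<xi> \<eta>
    by (simp add: power2_diff algebra_simps)
  have inner: "(\<integral>\<eta>. (u \<xi> - u \<eta>)\<^sup>2 \<partial>M) = (u \<xi>)\<^sup>2 - 2 * u \<xi> * m + s" for \<xi>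
    unfolding e m_def s_def using i1 i2 by (simp add: prob_space)
  have inner_nn: "(\<integral>\<^sup>+\<eta>. ennreal ((u \<xi> - u \<eta>)\<^sup>2) \<partial>M) = ennreal ((u \<xi>)\<^sup>2 - 2 * u \<xi> * m + s)" for \<xi>
  proof -
    have "integrable M (\<lambda>\<eta>. (u \<xi> - u \<eta>)\<^sup>2)"
      unfolding e using i1 i2 by auto
    then show ?thesis
      by (subst nn_integral_eq_integral) (simp_all add: inner)
  qed
  have pos: "0 \<le> (u \<xi>)\<^sup>2 - 2 * u \<xi> * m + s" for \<xi>
    unfolding inner[symmetric] by (rule Bochner_Integration.integral_nonneg) simp
  have int: "integrable M (\<lambda>\<xi>. (u \<xi>)\<^sup>2 - 2 * u \<xi> * m + s)"
    using i1 i2 by auto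
  have "(\<integral>\<xi>. (u \<xi>)\<^sup>2 - 2 * u \<xi> * m + s \<partial>M) = 2 * s - 2 * m\<^sup>2"
    using i1 i2 by (simp add: prob_space m_def s_def power2_eq_square)
  moreover from this have "0 \<le> 2 * s - 2 * m\<^sup>2"
    using Bochner_Integration.integral_nonneg[of M "\<lambda>\<xi>. (u \<xi>)\<^sup>2 - 2 * u \<xi> * m + s"] pos by simp
  moreover have "(\<integral>\<^sup>+\<xi>. ennreal ((u \<xi>)\<^sup>2) \<partial>M) = ennreal s"
    unfolding s_def using i2 by (intro nn_integral_eq_integral) auto
  moreover have "0 \<le> s"
    by (simp add: s_def)
  ultimately show ?thesis
    using pos int
    by (simp add: inner_nn nn_integral_eq_integral m_def[symmetric] flip: ennreal_plus ennreal_numeral ennreal_mult)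
qed

text \<open>
  The interval \<open>[-1, 3]\<close> is one period: this is a squared distance in \<open>L\<^sup>2\<close> of the circle of length 4,
  intended for 4-periodic \<open>g\<close>.
\<close>
definition sq_increment :: "(real \<Rightarrow> real) \<Rightarrow> real \<Rightarrow> ennreal" where
  "sq_increment g h = (\<integral>\<^sup>+x. ennreal ((g (x + h) - g x)\<^sup>2) \<partial>unif (-1) 3)"

definition mean_sq_increment :: "(real \<Rightarrow> real) \<Rightarrow> real measure \<Rightarrow> ennreal" where
  "mean_sq_increment g \<mu> = (\<integral>\<^sup>+\<xi>. \<integral>\<^sup>+\<eta>. sq_increment g (\<xi> - \<eta>) \<partial>\<mu> \<partial>\<mu>)"

lemma sigma_finite_unif: "a < b \<Longrightarrow> sigma_finite_measure (unif a b)"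
  by (simp add: prob_space_unif prob_space_imp_sigma_finite)

lemma measurable_sq_increment [measurable]:
  assumes [measurable]: "g \<in> borel_measurable borel"
  shows "sq_increment g \<in> borel_measurable borel"
proof -
  interpret sigma_finite_measure "unif (-1) 3" by (rule sigma_finite_unif) simp
  show ?thesis unfolding sq_increment_def by measurable
qed

lemma nn_integral_circle_shift:
  fixes F :: "real \<Rightarrow> ennreal"
  assumes "F \<in> borel_measurable borel" "\<And>x. F (x + 4) = F x"
  shows "(\<integral>\<^sup>+x. F (x + h) \<partial>unif (-1) 3) = (\<integral>\<^sup>+x. F x \<partial>unif (-1) 3)"
  using nn_integral_unif_periodic_shift[where F = F and p = 4 and h = h and a = "-1"] assms by simp

text \<open>
  Telescope \<open>g (x + n h) - g x\<close> into \<open>n\<close> increments of step \<open>h\<close> and apply the Cauchy-Schwarz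
  inequality. After integration over a period all \<open>n\<close> terms agree by translation invariance.
\<close>
lemma sq_increment_mult_le:
  assumes [measurable]: "g \<in> borel_measurable borel" and per: "\<And>x. g (x + 4) = g x"
  shows "sq_increment g (real n * h) \<le> ennreal ((real n)\<^sup>2) * sq_increment g h"
proof -
  let ?d = "\<lambda>y. (g (y + h) - g y)\<^sup>2"
  have pt: "(g (x + real n * h) - g x)\<^sup>2 \<le> real n * (\<Sum>k<n. ?d (x + real k * h))" for x
  proof -
    have "g (x + real n * h) - g x = (\<Sum>k<n. g (x + real (Suc k) * h) - g (x + real k * h))"
      by (subst sum_lessThan_telescope) simp
    also have "\<dots> = (\<Sum>k<n. g (x + real k * h + h) - g (x + real k * h))"
      by (simp add: algebra_simps)
    finally show ?thesis
      using sum_squared_le_sum_of_squares[of "\<lambda>k. g (x + real k * h + h) - g (x + real k * h)" "{..<n}"]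
      by (simp add: mult.commute)
  qed
  have "sq_increment g (real n * h) \<le> (\<integral>\<^sup>+x. ennreal (real n) * (\<Sum>k<n. ennreal (?d (x + real k * h))) \<partial>unif (-1) 3)"
    unfolding sq_increment_def
    by (rule nn_integral_mono) (use pt in \<open>simp add: sum_nonneg flip: ennreal_mult\<close>)
  also have "\<dots> = ennreal (real n) * (\<Sum>k<n. \<integral>\<^sup>+x. ennreal (?d (x + real k * h)) \<partial>unif (-1) 3)"
    by (subst nn_integral_cmult, simp, subst nn_integral_sum) simp_all
  also have "\<dots> = ennreal (real n) * (\<Sum>k<n. sq_increment g h)"
  proof -
    have "(\<integral>\<^sup>+x. ennreal (?d (x + real k * h)) \<partial>unif (-1) 3) = sq_increment g h" for k
      unfolding sq_increment_def
    proof (rule nn_integral_circle_shift)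
      show "ennreal (?d (x + 4)) = ennreal (?d x)" for x
        using per[of x] per[of "x + h"] by (simp add: add.assoc add.commute[of 4])
    qed simp
    then show ?thesis by simp
  qed
  also have "\<dots> = ennreal ((real n)\<^sup>2) * sq_increment g h"
    by (simp add: power2_eq_square ennreal_mult ennreal_of_nat_eq_real_of_nat mult.assoc)
  finally show ?thesis .
qed

text \<open>
  Independent points of \<open>\<U>(-r, r)\<close> are \<open>n\<close> times independent points of \<open>\<U>(-r/n, r/n)\<close>.
\<close>
lemma mean_sq_increment_scale:
  assumes [measurable]: "g \<in> borel_measurable borel" and per: "\<And>x. g (x + 4) = g x"
    and "n > 0" "r > 0"
  shows "mean_sq_increment g (unif (-r) r)
    \<le> ennreal ((real n)\<^sup>2) * mean_sq_increment g (unif (-(r / n)) (r / n))"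
proof -
  let ?\<nu> = "unif (-(r / n)) (r / n)"
  have r: "unif (-r) r = distr ?\<nu> borel (\<lambda>x. real n * x)"
    using assms distr_unif_affine[of "-(r / n)" "r / n" "real n" 0] by simp
  interpret sigma_finite_measure ?\<nu> by (rule sigma_finite_unif) (use assms in simp)
  interpret R: sigma_finite_measure "unif (-r) r" by (rule sigma_finite_unif) (use assms in simp)
  have "mean_sq_increment g (unif (-r) r) = (\<integral>\<^sup>+\<xi>. \<integral>\<^sup>+\<eta>. sq_increment g (real n * \<xi> - \<eta>) \<partial>unif (-r) r \<partial>?\<nu>)"
    unfolding mean_sq_increment_def by (subst r, subst nn_integral_distr) auto
  also have "\<dots> = (\<integral>\<^sup>+\<xi>. \<integral>\<^sup>+\<eta>. sq_increment g (real n * \<xi> - real n * \<eta>) \<partial>?\<nu> \<partial>?\<nu>)"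
    by (subst r, subst nn_integral_distr) auto
  also have "\<dots> = (\<integral>\<^sup>+\<xi>. \<integral>\<^sup>+\<eta>. sq_increment g (real n * (\<xi> - \<eta>)) \<partial>?\<nu> \<partial>?\<nu>)"
    by (simp add: algebra_simps)
  also have "\<dots> \<le> (\<integral>\<^sup>+\<xi>. \<integral>\<^sup>+\<eta>. ennreal ((real n)\<^sup>2) * sq_increment g (\<xi> - \<eta>) \<partial>?\<nu> \<partial>?\<nu>)"
    by (intro nn_integral_mono sq_increment_mult_le assms)
  also have "\<dots> = ennreal ((real n)\<^sup>2) * mean_sq_increment g ?\<nu>"
    unfolding mean_sq_increment_def by (simp add: nn_integral_cmult)
  finally show ?thesis .
qed

lemma mean_sq_increment_mono:
  assumes [measurable]: "g \<in> borel_measurable borel" and "0 < b" "b \<le> a"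
  shows "mean_sq_increment g (unif (-b) b) \<le> ennreal ((a / b)\<^sup>2) * mean_sq_increment g (unif (-a) a)"
proof -
  interpret A: sigma_finite_measure "unif (-a) a" by (rule sigma_finite_unif) (use assms in simp)
  interpret B: sigma_finite_measure "unif (-b) b" by (rule sigma_finite_unif) (use assms in simp)
  have "mean_sq_increment g (unif (-b) b) \<le> ennreal (a / b) * (\<integral>\<^sup>+\<xi>. \<integral>\<^sup>+\<eta>. sq_increment g (\<xi> - \<eta>) \<partial>unif (-b) b \<partial>unif (-a) a)"
    unfolding mean_sq_increment_def using assms by (intro nn_integral_unif_mono) auto
  also have "\<dots> \<le> ennreal (a / b) * (\<integral>\<^sup>+\<xi>. ennreal (a / b) * (\<integral>\<^sup>+\<eta>. sq_increment g (\<xi> - \<eta>) \<partial>unif (-a) a) \<partial>unif (-a) a)"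
    using assms by (intro mult_left_mono nn_integral_mono nn_integral_unif_mono) auto
  also have "\<dots> = ennreal ((a / b)\<^sup>2) * mean_sq_increment g (unif (-a) a)"
    unfolding mean_sq_increment_def power2_eq_square
    using assms by (subst nn_integral_cmult, simp, subst ennreal_mult) (simp_all add: mult.assoc)
  finally show ?thesis .
qed

text \<open>
  Averaging \<open>g (x + \<xi>)\<close> over \<open>\<xi>\<close> with law \<open>\<mu>\<close> loses in squared norm the variance of \<open>\<xi> \<mapsto> g (x + \<xi>)\<close>,
  averaged over \<open>x\<close>. Translation invariance turns the integral over \<open>x\<close> of
  \<open>(g (x + \<xi>) - g (x + \<eta>))\<^sup>2\<close> into a function of \<open>\<xi> - \<eta>\<close>.
\<close>
lemma energy_identity:
  assumes [measurable]: "g \<in> borel_measurable borel" and per: "\<And>x. g (x + 4) = g x"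
    and fin: "(\<integral>\<^sup>+x. ennreal ((g x)\<^sup>2) \<partial>unif (-1) 3) < \<infinity>"
    and \<mu>: "prob_space \<mu>" "sets \<mu> = sets borel"
  shows "2 * (\<integral>\<^sup>+x. ennreal ((\<integral>\<xi>. g (x + \<xi>) \<partial>\<mu>)\<^sup>2) \<partial>unif (-1) 3) + mean_sq_increment g \<mu>
    = 2 * (\<integral>\<^sup>+x. ennreal ((g x)\<^sup>2) \<partial>unif (-1) 3)"
proof -
  let ?C = "unif (-1) 3"
  interpret \<mu>: prob_space \<mu> by fact
  interpret C: prob_space ?C by (rule prob_space_unif) simp
  interpret P: pair_sigma_finite ?C \<mu> ..
  note \<mu>(2) [measurable_cong]
  have [simp]: "space \<mu> = UNIV"
    using sets_eq_imp_space_eq[OF \<mu>(2)] by simp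
  have swap: "(\<integral>\<^sup>+x. \<integral>\<^sup>+\<xi>. F x \<xi> \<partial>\<mu> \<partial>?C) = (\<integral>\<^sup>+\<xi>. \<integral>\<^sup>+x. F x \<xi> \<partial>?C \<partial>\<mu>)"
    if "case_prod F \<in> borel_measurable (borel \<Otimes>\<^sub>M borel)" for F :: "real \<Rightarrow> real \<Rightarrow> ennreal"
    using P.Fubini'[of F] that
    by (simp add: measurable_cong_sets[OF sets_pair_measure_cong[OF sets_unif \<mu>(2)] refl])
  have sh: "(\<integral>\<^sup>+x. ennreal ((g (x + \<xi>))\<^sup>2) \<partial>?C) = (\<integral>\<^sup>+x. ennreal ((g x)\<^sup>2) \<partial>?C)" for \<xi>
    by (rule nn_integral_circle_shift[of "\<lambda>y. ennreal ((g y)\<^sup>2)"]) (auto simp: per)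
  have sq: "(\<integral>\<^sup>+x. \<integral>\<^sup>+\<xi>. ennreal ((g (x + \<xi>))\<^sup>2) \<partial>\<mu> \<partial>?C) = (\<integral>\<^sup>+x. ennreal ((g x)\<^sup>2) \<partial>?C)"
    by (subst swap) (auto simp: sh \<mu>.emeasure_space_1[simplified])
  have inc: "(\<integral>\<^sup>+x. ennreal ((g (x + \<xi>) - g (x + \<eta>))\<^sup>2) \<partial>?C) = sq_increment g (\<xi> - \<eta>)" for \<xi> \<eta>
    using nn_integral_circle_shift[of "\<lambda>y. ennreal ((g (y + (\<xi> - \<eta>)) - g y)\<^sup>2)" \<eta>] per[of "_ + (\<xi> - \<eta>)"] per
    by (simp add: sq_increment_def algebra_simps)
  have dbl: "(\<integral>\<^sup>+x. \<integral>\<^sup>+\<xi>. \<integral>\<^sup>+\<eta>. ennreal ((g (x + \<xi>) - g (x + \<eta>))\<^sup>2) \<partial>\<mu> \<partial>\<mu> \<partial>?C) = mean_sq_increment g \<mu>"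
  proof -
    have "(\<integral>\<^sup>+x. \<integral>\<^sup>+\<xi>. \<integral>\<^sup>+\<eta>. ennreal ((g (x + \<xi>) - g (x + \<eta>))\<^sup>2) \<partial>\<mu> \<partial>\<mu> \<partial>?C)
      = (\<integral>\<^sup>+\<xi>. \<integral>\<^sup>+x. \<integral>\<^sup>+\<eta>. ennreal ((g (x + \<xi>) - g (x + \<eta>))\<^sup>2) \<partial>\<mu> \<partial>?C \<partial>\<mu>)"
      by (rule swap) measurable
    also have "\<dots> = (\<integral>\<^sup>+\<xi>. \<integral>\<^sup>+\<eta>. \<integral>\<^sup>+x. ennreal ((g (x + \<xi>) - g (x + \<eta>))\<^sup>2) \<partial>?C \<partial>\<mu> \<partial>\<mu>)"
      by (intro nn_integral_cong swap) measurable
    finally show ?thesis by (simp add: inc mean_sq_increment_def)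
  qed
  \<comment> \<open>Square integrability along the window is only available for almost every centre \<open>x\<close>,
      by Tonelli's theorem.\<close>
  have "AE x in ?C. (\<integral>\<^sup>+\<xi>. ennreal ((g (x + \<xi>))\<^sup>2) \<partial>\<mu>) \<noteq> \<infinity>"
    using fin by (intro nn_integral_PInf_AE) (auto simp: sq)
  then have "AE x in ?C. 2 * ennreal ((\<integral>\<xi>. g (x + \<xi>) \<partial>\<mu>)\<^sup>2)
      + (\<integral>\<^sup>+\<xi>. \<integral>\<^sup>+\<eta>. ennreal ((g (x + \<xi>) - g (x + \<eta>))\<^sup>2) \<partial>\<mu> \<partial>\<mu>)
     = 2 * (\<integral>\<^sup>+\<xi>. ennreal ((g (x + \<xi>))\<^sup>2) \<partial>\<mu>)"
    by eventually_elim (rule \<mu>.square_mean_plus_pair_difference, auto simp: less_top)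
  then have "(\<integral>\<^sup>+x. 2 * ennreal ((\<integral>\<xi>. g (x + \<xi>) \<partial>\<mu>)\<^sup>2)
      + (\<integral>\<^sup>+\<xi>. \<integral>\<^sup>+\<eta>. ennreal ((g (x + \<xi>) - g (x + \<eta>))\<^sup>2) \<partial>\<mu> \<partial>\<mu>) \<partial>?C)
     = (\<integral>\<^sup>+x. 2 * (\<integral>\<^sup>+\<xi>. ennreal ((g (x + \<xi>))\<^sup>2) \<partial>\<mu>) \<partial>?C)"
    by (rule nn_integral_cong_AE)
  then show ?thesis
    by (simp add: nn_integral_add nn_integral_cmult dbl sq)
qed

section \<open>The spectral gap\<close>

text \<open>
  A Poincare inequality on the circle in which increments at scale \<open>\<epsilon>\<close> take the place of the
  gradient. The hypothesis on the mean makes windows of radius 2, which cover one period,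
  average to zero, so that \<open>2 \<parallel>g\<parallel>\<^sup>2\<close> is itself a mean squared increment at scale 2.
\<close>
lemma poincare_circle:
  assumes [measurable]: "g \<in> borel_measurable borel" and per: "\<And>x. g (x + 4) = g x"
    and fin: "(\<integral>\<^sup>+x. ennreal ((g x)\<^sup>2) \<partial>unif (-1) 3) < \<infinity>"
    and mean: "\<And>x. (\<integral>\<xi>. g (x + \<xi>) \<partial>unif (-2) 2) = 0"
    and \<epsilon>: "0 < \<epsilon>" "\<epsilon> \<le> 1"
  shows "2 * (\<integral>\<^sup>+x. ennreal ((g x)\<^sup>2) \<partial>unif (-1) 3)
     \<le> ennreal (81 / (4 * \<epsilon>\<^sup>2)) * mean_sq_increment g (unif (-\<epsilon>) \<epsilon>)"
proof -
  define n where "n = nat \<lceil>2 / \<epsilon>\<rceil>"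
  have n: "2 / \<epsilon> \<le> real n" "real n \<le> 2 / \<epsilon> + 1"
    using \<epsilon> by (auto simp: n_def of_nat_nat ceiling_correct intro: order_trans)
  have "n > 0"
    using n(1) \<epsilon> by (intro gr0I) (auto simp: field_simps)
  have n2: "2 / real n \<le> \<epsilon>" "real n * \<epsilon> \<le> 3"
  proof -
    show "2 / real n \<le> \<epsilon>" using n(1) \<epsilon> \<open>n > 0\<close> by (simp add: field_simps)
    have "real n * \<epsilon> \<le> (2 / \<epsilon> + 1) * \<epsilon>" using n(2) \<epsilon> by (intro mult_right_mono) auto
    also have "\<dots> \<le> 3" using \<epsilon> by (simp add: field_simps)
    finally show "real n * \<epsilon> \<le> 3" .
  qed
  have "2 * (\<integral>\<^sup>+x. ennreal ((g x)\<^sup>2) \<partial>unif (-1) 3) = mean_sq_increment g (unif (-2) 2)"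
    using energy_identity[OF assms(1) per fin, of "unif (-2) 2"] by (simp add: mean prob_space_unif)
  also have "\<dots> \<le> ennreal ((real n)\<^sup>2) * mean_sq_increment g (unif (-(2 / n)) (2 / n))"
    using \<open>n > 0\<close> by (intro mean_sq_increment_scale per) auto
  also have "\<dots> \<le> ennreal ((real n)\<^sup>2) * (ennreal ((\<epsilon> / (2 / n))\<^sup>2) * mean_sq_increment g (unif (-\<epsilon>) \<epsilon>))"
    using \<open>n > 0\<close> n2 by (intro mult_left_mono mean_sq_increment_mono) auto
  also have "\<dots> = ennreal ((real n)\<^sup>2 * (\<epsilon> / (2 / n))\<^sup>2) * mean_sq_increment g (unif (-\<epsilon>) \<epsilon>)"
    by (subst ennreal_mult) (auto simp: mult.assoc)
  also have "\<dots> \<le> ennreal (81 / (4 * \<epsilon>\<^sup>2)) * mean_sq_increment g (unif (-\<epsilon>) \<epsilon>)"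
  proof (intro mult_right_mono ennreal_leI)
    have "(real n * \<epsilon>) ^ 4 \<le> 3 ^ 4"
      using n2 \<epsilon> by (intro power_mono) auto
    then show "(real n)\<^sup>2 * (\<epsilon> / (2 / n))\<^sup>2 \<le> 81 / (4 * \<epsilon>\<^sup>2)"
      using \<epsilon> by (simp add: field_simps power_mult_distrib power2_eq_square power4_eq_xxxx)
  qed simp
  finally show ?thesis .
qed

lemma kernel_op_RURWM:
  assumes [measurable]: "f \<in> borel_measurable borel"
  shows "kernel_op (Q_RURWM \<epsilon>) f x = (\<integral>\<xi>. f (reflect (x + \<xi>)) \<partial>unif (-\<epsilon>) \<epsilon>)"
  unfolding kernel_op_def Q_RURWM_def by (subst integral_distr) auto

text \<open>
  The symmetric increment law makes the image of \<open>f \<circ> reflect\<close> inherit the symmetry about 1.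
  This is what allows norms of the image to be computed over a full period as well.
\<close>
lemma kernel_op_RURWM_reflect:
  assumes [measurable]: "f \<in> borel_measurable borel" and "\<epsilon> > 0" "x \<in> {-1..3}"
  shows "kernel_op (Q_RURWM \<epsilon>) f (reflect x) = kernel_op (Q_RURWM \<epsilon>) f x"
proof (cases "x \<le> 1")
  case True
  then show ?thesis using assms by (simp add: reflect_eq_id)
next
  case False
  have sym: "unif (-\<epsilon>) \<epsilon> = distr (unif (-\<epsilon>) \<epsilon>) borel (\<lambda>x. -x)"
    using distr_unif_affine[of "-\<epsilon>" \<epsilon> "-1" 0] assms by simp
  have "kernel_op (Q_RURWM \<epsilon>) f (2 - x) = (\<integral>\<xi>. f (reflect (2 - (x - \<xi>))) \<partial>unif (-\<epsilon>) \<epsilon>)"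
    by (simp add: kernel_op_RURWM algebra_simps)
  also have "\<dots> = (\<integral>\<xi>. f (reflect (x - \<xi>)) \<partial>unif (-\<epsilon>) \<epsilon>)"
    by (simp only: reflect_symmetric)
  also have "\<dots> = (\<integral>\<xi>. f (reflect (x + \<xi>)) \<partial>unif (-\<epsilon>) \<epsilon>)"
  proof -
    have "(\<integral>\<xi>. f (reflect (x + \<xi>)) \<partial>distr (unif (-\<epsilon>) \<epsilon>) borel (\<lambda>x. -x))
        = (\<integral>\<xi>. f (reflect (x + - \<xi>)) \<partial>unif (-\<epsilon>) \<epsilon>)"
      by (rule integral_distr) auto
    then show ?thesis by (simp flip: sym)
  qed
  finally show ?thesis
    using False assms by (simp add: reflect_eq_diff kernel_op_RURWM)
qed

lemma kernel_op_RURWM_contraction: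
  assumes f: "f \<in> L2_zero_mean (unif (-1) 1)" and \<epsilon>: "0 < \<epsilon>" "\<epsilon> \<le> 1"
  shows "(\<integral>x. (kernel_op (Q_RURWM \<epsilon>) f x)\<^sup>2 \<partial>unif (-1) 1)
     \<le> (1 - 4 * \<epsilon>\<^sup>2 / 81) * (\<integral>x. (f x)\<^sup>2 \<partial>unif (-1) 1)"
proof -
  let ?K = "kernel_op (Q_RURWM \<epsilon>) f"
  let ?m = "mean_sq_increment (\<lambda>x. f (reflect x)) (unif (-\<epsilon>) \<epsilon>)"
  have [measurable]: "f \<in> borel_measurable borel"
    using f measurable_cong_sets[OF sets_unif refl] by (auto simp: L2_zero_mean_def)
  have f2: "integrable (unif (-1) 1) (\<lambda>x. (f x)\<^sup>2)" and mean: "(\<integral>x. f x \<partial>unif (-1) 1) = 0"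
    using f by (auto simp: L2_zero_mean_def)
  interpret U: sigma_finite_measure "unif (-\<epsilon>) \<epsilon>" by (rule sigma_finite_unif) (use \<epsilon> in simp)
  have K [measurable]: "?K \<in> borel_measurable borel"
  proof -
    have "?K = (\<lambda>x. \<integral>\<xi>. f (reflect (x + \<xi>)) \<partial>unif (-\<epsilon>) \<epsilon>)"
      by (simp add: fun_eq_iff kernel_op_RURWM)
    then show ?thesis by simp
  qed
  define s where "s = (\<integral>x. (f x)\<^sup>2 \<partial>unif (-1) 1)"
  have s0: "s \<ge> 0" by (simp add: s_def)
  have s: "(\<integral>\<^sup>+x. ennreal ((f (reflect x))\<^sup>2) \<partial>unif (-1) 3) = ennreal s"
    using f2 by (subst nn_integral_reflect[of "\<lambda>x. ennreal ((f x)\<^sup>2)"])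
      (simp_all add: nn_integral_eq_integral s_def)
  have k: "(\<integral>\<^sup>+x. ennreal ((?K x)\<^sup>2) \<partial>unif (-1) 1)
      = (\<integral>\<^sup>+x. ennreal ((\<integral>\<xi>. f (reflect (x + \<xi>)) \<partial>unif (-\<epsilon>) \<epsilon>)\<^sup>2) \<partial>unif (-1) 3)"
  proof -
    have "(\<integral>\<^sup>+x. ennreal ((?K x)\<^sup>2) \<partial>unif (-1) 1) = (\<integral>\<^sup>+x. ennreal ((?K (reflect x))\<^sup>2) \<partial>unif (-1) 3)"
      by (rule nn_integral_reflect[symmetric]) simp
    also have "\<dots> = (\<integral>\<^sup>+x. ennreal ((?K x)\<^sup>2) \<partial>unif (-1) 3)"
      by (rule nn_integral_cong_AE, rule AE_mp[OF AE_unif])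
         (use \<epsilon> in \<open>auto simp: kernel_op_RURWM_reflect\<close>)
    finally show ?thesis by (simp add: kernel_op_RURWM)
  qed
  have mean': "(\<integral>\<xi>. f (reflect (x + \<xi>)) \<partial>unif (-2) 2) = 0" for x
  proof -
    have "(\<integral>\<xi>. f (reflect (x + \<xi>)) \<partial>unif (-2) 2) = (\<integral>y. f y \<partial>distr (unif (-2) 2) borel (\<lambda>\<xi>. reflect (x + \<xi>)))"
      by (subst integral_distr) auto
    then show ?thesis
      using distr_reflect_unif_period[of "-2" x] mean by simp
  qed
  have en: "2 * (\<integral>\<^sup>+x. ennreal ((?K x)\<^sup>2) \<partial>unif (-1) 1) + ?m = 2 * ennreal s"
    unfolding k s[symmetric]
    by (rule energy_identity) (use \<epsilon> in \<open>auto simp: reflect_periodic s prob_space_unif\<close>)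
  have po: "2 * ennreal s \<le> ennreal (81 / (4 * \<epsilon>\<^sup>2)) * ?m"
    unfolding s[symmetric]
    by (rule poincare_circle) (use \<epsilon> mean' in \<open>auto simp: reflect_periodic s\<close>)
  have "2 * (\<integral>\<^sup>+x. ennreal ((?K x)\<^sup>2) \<partial>unif (-1) 1) + ?m < \<infinity>"
    unfolding en by (simp add: ennreal_mult_less_top)
  then obtain k m where km: "(\<integral>\<^sup>+x. ennreal ((?K x)\<^sup>2) \<partial>unif (-1) 1) = ennreal k" "k \<ge> 0"
      "?m = ennreal m" "m \<ge> 0"
    by (cases "\<integral>\<^sup>+x. ennreal ((?K x)\<^sup>2) \<partial>unif (-1) 1"; cases ?m) (auto simp: ennreal_mult_less_top)
  have "2 * k + m = 2 * s"
    using en km s0 by (simp flip: ennreal_numeral ennreal_mult ennreal_plus)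
  moreover have "2 * s \<le> 81 / (4 * \<epsilon>\<^sup>2) * m"
    using po km s0 by (simp flip: ennreal_numeral ennreal_mult)
  then have "m \<ge> 8 * \<epsilon>\<^sup>2 * s / 81"
    using \<epsilon> by (simp add: field_simps)
  ultimately have "k \<le> (1 - 4 * \<epsilon>\<^sup>2 / 81) * s"
    by (simp add: field_simps)
  moreover have "(\<integral>x. (?K x)\<^sup>2 \<partial>unif (-1) 1) = k"
    using km by (subst integral_eq_nn_integral) auto
  ultimately show ?thesis by (simp add: s_def)
qed

text \<open>
  The supremum defining the contraction coefficient is over a nonempty set; otherwise an upper
  bound for all its members would say nothing about it.
\<close>
lemma L2_zero_mean_unif_nontrivial:
  "\<exists>f \<in> L2_zero_mean (unif (-1) 1). \<not> (AE x in unif (-1) 1. f x = 0)"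
proof (intro bexI)
  let ?\<pi> = "unif (-1) 1"
  interpret prob_space ?\<pi> by (rule prob_space_unif) simp
  have sym: "distr ?\<pi> borel (\<lambda>x. -x) = ?\<pi>"
    using distr_unif_affine[of "-1" 1 "-1" 0] by simp
  have "integrable ?\<pi> (\<lambda>x. x\<^sup>2)"
    by (rule integrable_const_bound[where B = 1])
       (rule AE_mp[OF AE_unif], auto simp: abs_square_le_1)
  moreover have "(\<integral>x. x \<partial>distr ?\<pi> borel (\<lambda>x. -x)) = (\<integral>x. -x \<partial>?\<pi>)"
    by (rule integral_distr) auto
  then have "(\<integral>x. x \<partial>?\<pi>) = 0"
    by (simp add: sym)
  ultimately show "(\<lambda>x. x) \<in> L2_zero_mean ?\<pi>"
    by (simp add: L2_zero_mean_def)
  show "\<not> (AE x in ?\<pi>. x = 0)"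
  proof
    assume "AE x in ?\<pi>. x = 0"
    then have "AE x in lborel. x \<in> {-1..1} \<longrightarrow> x = (0::real)"
      unfolding unif_def by (subst (asm) AE_uniform_measure) auto
    with AE_lborel_singleton[of "0::real"] have "AE x in lborel. x \<notin> {-1..1::real}"
      by eventually_elim auto
    then have "emeasure lborel {-1..1::real} = 0"
      by (subst (asm) AE_iff_measurable[of "{-1..1}"]) auto
    then show False by simp
  qed
qed


theorem theorem4p1:
  shows "\<exists>c::real. c > 0 \<and>
    (\<forall>\<epsilon>::real. 0 < \<epsilon> \<and> \<epsilon> \<le> 1 \<longrightarrow>
       L2_spectral_gap (unif (-1) 1) (Q_RURWM \<epsilon>) \<ge> c * \<epsilon>\<^sup>2)"
proof (intro exI[of _ "2 / 81"] conjI allI impI)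
  fix \<epsilon> :: real assume "0 < \<epsilon> \<and> \<epsilon> \<le> 1"
  then have \<epsilon>: "0 < \<epsilon>" "\<epsilon> \<le> 1" by auto
  let ?\<pi> = "unif (-1) 1"
  have \<epsilon>2: "\<epsilon>\<^sup>2 \<le> 1" using \<epsilon> by (simp add: power_le_one)
  have "L2_norm ?\<pi> (kernel_op (Q_RURWM \<epsilon>) f) / L2_norm ?\<pi> f \<le> 1 - 2 / 81 * \<epsilon>\<^sup>2"
    if f: "f \<in> L2_zero_mean ?\<pi>" for f
  proof -
    \<comment> \<open>Squaring \<open>1 - t / 2\<close> gives at least \<open>1 - t\<close>.\<close>
    have "1 - 4 * \<epsilon>\<^sup>2 / 81 \<le> (1 - 2 / 81 * \<epsilon>\<^sup>2)\<^sup>2"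
      by (simp add: power2_diff)
    then have "(\<integral>x. (kernel_op (Q_RURWM \<epsilon>) f x)\<^sup>2 \<partial>?\<pi>)
        \<le> (1 - 2 / 81 * \<epsilon>\<^sup>2)\<^sup>2 * (\<integral>x. (f x)\<^sup>2 \<partial>?\<pi>)"
      by (intro order_trans[OF kernel_op_RURWM_contraction[OF f \<epsilon>]] mult_right_mono) auto
    then have "L2_norm ?\<pi> (kernel_op (Q_RURWM \<epsilon>) f)
        \<le> sqrt ((1 - 2 / 81 * \<epsilon>\<^sup>2)\<^sup>2 * (\<integral>x. (f x)\<^sup>2 \<partial>?\<pi>))"
      unfolding L2_norm_def by (rule real_sqrt_le_mono)
    also have "\<dots> = (1 - 2 / 81 * \<epsilon>\<^sup>2) * L2_norm ?\<pi> f"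
      using \<epsilon>2 by (simp add: L2_norm_def real_sqrt_mult)
    finally have le: "L2_norm ?\<pi> (kernel_op (Q_RURWM \<epsilon>) f) \<le> (1 - 2 / 81 * \<epsilon>\<^sup>2) * L2_norm ?\<pi> f" .
    have "L2_norm ?\<pi> f \<ge> 0"
      by (simp add: L2_norm_def)
    then show ?thesis
      using le \<epsilon>2 by (cases "L2_norm ?\<pi> f = 0") (simp_all add: pos_divide_le_eq)
  qed
  then have "L2_contraction ?\<pi> (Q_RURWM \<epsilon>) \<le> 1 - 2 / 81 * \<epsilon>\<^sup>2"
    unfolding L2_contraction_def using L2_zero_mean_unif_nontrivial by (intro cSUP_least) auto
  then show "L2_spectral_gap ?\<pi> (Q_RURWM \<epsilon>) \<ge> 2 / 81 * \<epsilon>\<^sup>2"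
    by (simp add: L2_spectral_gap_def)
qed simp

end
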